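(* Let $F$ be an algebraically closed field, let $V$ be a non-zero finite dimensional vector space over $F$ with $m=\dim V$, and let $\mathcal{S}=\{x_1,\dots,x_n\}$ ($n\ge 1$) be a uniserial family of pairwise commuting endomorphisms of $V$. Then there are an index $1\le i\le n$, a scalar $\alpha\in F$, and a basis of $V$ relative to which $x_i$ is represented by the upper triangular Jordan block $J_m(\alpha)$ and every other $x_j$ is represented by a polynomial (with coefficients in $F$) in $J_m(\alpha)$.
   Context: A family $\mathcal{S}$ of endomorphisms of a non-zero vector space $V$ is called uniserial if the $\mathcal{S}$-invariant subspaces of $V$ form a chain under inclusion. $J_m(\alpha)$ denotes the $m\times m$ upper triangular Jordan block with eigenvalue $\alpha$ ($\alpha$ on the diagonal, $1$ on the first superdiagonal, $0$ elsewhere). *)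

theory Defs
  imports "Jordan_Normal_Form.Jordan_Normal_Form"
begin

(* In the next four definitions, scale is the scalar multiplication of a vector space
   whose carrier is the whole type 'v. *)

definition invariant_subspaces ::
    "('f::field \<Rightarrow> 'v::ab_group_add \<Rightarrow> 'v) \<Rightarrow> ('v \<Rightarrow> 'v) set \<Rightarrow> 'v set set" where
  "invariant_subspaces scale S = {W. module.subspace scale W \<and> (\<forall>f\<in>S. f ` W \<subseteq> W)}"

(* Linearity of the members of S and non-triviality of the space are not part of the predicate. *)
definition uniserial ::
    "('f::field \<Rightarrow> 'v::ab_group_add \<Rightarrow> 'v) \<Rightarrow> ('v \<Rightarrow> 'v) set \<Rightarrow> bool" where
  "uniserial scale S \<longleftrightarrow> chain_subset (invariant_subspaces scale S)"

definition ordered_basis ::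
    "('f::field \<Rightarrow> 'v::ab_group_add \<Rightarrow> 'v) \<Rightarrow> 'v list \<Rightarrow> bool" where
  "ordered_basis scale bs \<longleftrightarrow>
     distinct bs \<and> \<not> module.dependent scale (set bs) \<and> module.span scale (set bs) = UNIV"

(* Column convention: column j of A holds the coordinates of the image of the j-th basis vector. *)
definition represented_by ::
    "('f::field \<Rightarrow> 'v::ab_group_add \<Rightarrow> 'v) \<Rightarrow> 'v list \<Rightarrow> ('v \<Rightarrow> 'v) \<Rightarrow> 'f mat \<Rightarrow> bool" where
  "represented_by scale bs f A \<longleftrightarrow>
     A \<in> carrier_mat (length bs) (length bs) \<and>
     (\<forall>j<length bs. f (bs ! j) = (\<Sum>i<length bs. scale (A $$ (i, j)) (bs ! i)))"

(* The matrix p(A), i.e. the sum of coeff p k times A^k over k, written entrywise because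
   the type of matrices of all sizes has no additive monoid structure. Only for square A. *)
definition poly_of_mat :: "'a::comm_ring_1 poly \<Rightarrow> 'a mat \<Rightarrow> 'a mat" where
  "poly_of_mat p A =
     mat (dim_row A) (dim_row A)
       (\<lambda>(r, c). \<Sum>k\<le>degree p. coeff p k * (A ^\<^sub>m k) $$ (r, c))"

end

theory Submission
  imports Defs
begin

text \<open>The scalar field is algebraically closed, so every \<open>x\<^sub>i\<close> has an eigenvalue \<open>a\<^sub>i\<close>. Put
\<open>y\<^sub>i = x\<^sub>i - a\<^sub>i\<close>. As the family commutes, kernels and ranges of polynomials in its members
are invariant subspaces, hence comparable with each other. Three consequences carry the proof.

The eigenspaces \<open>ker y\<^sub>j\<close> form a finite chain; let \<open>ker y\<^sub>i\<close> be the least of them. It lies in every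
\<open>ker y\<^sub>j\<close>, so the whole family acts on it by scalars, and all of its subspaces are invariant. A
space whose lines are pairwise comparable has dimension at most one, so \<open>ker y\<^sub>i\<close> is a line
(\<open>scalar_action_uniserial_imp_line\<close>).

For large \<open>N\<close>, Fitting's decomposition makes \<open>ker y\<^sub>i\<^sup>N\<close> and the range of \<open>y\<^sub>i\<^sup>N\<close> two complementary
invariant subspaces. Being comparable, one of them is zero, and the kernel is not; so \<open>y\<^sub>i\<close> is
nilpotent (\<open>uniserial_kernel_imp_nilpotent\<close>).

A nilpotent operator \<open>y\<close> whose kernel is a line consists of a single Jordan block: if \<open>y\<^sup>k v \<noteq> 0\<close> while
\<open>y\<close> has nilpotency index \<open>k + 1\<close>, then \<open>y\<^sup>k v, \<dots>, y v, v\<close> is a basis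
(\<open>nilpotent_one_dim_kernel_basis\<close>), and in it \<open>x\<^sub>i = a\<^sub>i + y\<close> is the upper triangular Jordan block.

In particular \<open>v\<close> is a cyclic vector of \<open>x\<^sub>i\<close>. An operator \<open>g\<close> that commutes with \<open>x\<^sub>i\<close> is determined
by \<open>g v\<close>, and \<open>g v = p(x\<^sub>i) v\<close> for some polynomial \<open>p\<close>, whence \<open>g = p(x\<^sub>i)\<close>
(\<open>commuting_eq_poly_operator\<close>). Passing to matrices turns this into a polynomial in the
Jordan block.\<close>

section \<open>Commuting operators and invariant subspaces\<close>

text \<open>A separate locale, because the locale \<open>vector_space\<close> is already interpreted globally for real vector
spaces: declarations made in it would be copied there and hide the ones for a general scalar
field.\<close>
locale vector_space_endomorphisms =
  vector_space scale + endo: vector_space_pair scale scale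
  for scale :: "'a::field \<Rightarrow> 'b::ab_group_add \<Rightarrow> 'b"
begin

lemma independent_if_not_in_span_of_predecessors:
  fixes b :: "nat \<Rightarrow> 'b"
  assumes "\<And>i. i < n \<Longrightarrow> b i \<notin> span (b ` {..<i})"
  shows "inj_on b {..<n} \<and> independent (b ` {..<n})"
  using assms
proof (induction n)
  case 0
  then show ?case by (simp add: independent_empty)
next
  case (Suc n)
  have ih: "inj_on b {..<n} \<and> independent (b ` {..<n})"
    by (rule Suc.IH) (simp add: Suc.prems)
  have new: "b n \<notin> span (b ` {..<n})"
    by (rule Suc.prems) simp
  then have "b n \<notin> b ` {..<n}"
    using span_base[of "b n"] by metis
  then have "inj_on b (insert n {..<n})"
    using ih by (simp add: inj_on_insert)
  moreover have "independent (insert (b n) (b ` {..<n}))"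
    using new ih by (simp add: independent_insert)
  ultimately show ?case by (simp add: lessThan_Suc)
qed

lemma linear_funpow:
  assumes "Vector_Spaces.linear scale scale f"
  shows "Vector_Spaces.linear scale scale (f ^^ k)"
proof (induction k)
  case 0
  show ?case using linear_id by (simp add: id_def)
next
  case (Suc k)
  show ?case
    using Vector_Spaces.linear_compose[OF Suc assms] by (simp add: comp_def)
qed

lemma linear_shift:
  assumes "Vector_Spaces.linear scale scale f"
  shows "Vector_Spaces.linear scale scale (\<lambda>w. f w - scale a w)"
  by (intro endo.linear_compose_sub assms endo.linear_compose_scale_right linear_ident)

lemma funpow_commute:
  assumes "\<And>w. f (g w) = g (f w)"
  shows "(f ^^ k) (g w) = g ((f ^^ k) w)"
  by (induction k) (simp_all add: assms)

lemma kernel_in_invariant_subspaces: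
  assumes lin: "Vector_Spaces.linear scale scale f"
    and S: "\<And>g. g \<in> S \<Longrightarrow> Vector_Spaces.linear scale scale g"
    and comm: "\<And>g w. g \<in> S \<Longrightarrow> f (g w) = g (f w)"
  shows "{w. f w = 0} \<in> invariant_subspaces scale S"
  unfolding invariant_subspaces_def
  using endo.linear_subspace_kernel[OF lin] endo.linear_0[OF S] by (auto simp: comm)

lemma range_in_invariant_subspaces:
  assumes lin: "Vector_Spaces.linear scale scale f"
    and comm: "\<And>g w. g \<in> S \<Longrightarrow> f (g w) = g (f w)"
  shows "range f \<in> invariant_subspaces scale S"
  unfolding invariant_subspaces_def
  using endo.linear_subspace_image[OF lin subspace_UNIV]
  by (auto simp: comm[symmetric])

lemma uniserial_comparable:
  assumes "uniserial scale S" "U \<in> invariant_subspaces scale S" "W \<in> invariant_subspaces scale S"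
  shows "U \<subseteq> W \<or> W \<subseteq> U"
  using assms unfolding uniserial_def chain_subset_def by blast

text \<open>The line through any nonzero vector of \<open>U\<close> is invariant; comparable lines are equal.\<close>
lemma scalar_action_uniserial_imp_line:
  assumes uni: "uniserial scale S"
    and S: "\<And>g. g \<in> S \<Longrightarrow> Vector_Spaces.linear scale scale g"
    and scalar: "\<And>g w. g \<in> S \<Longrightarrow> w \<in> U \<Longrightarrow> g w = scale (c g) w"
    and e: "e \<in> U" "e \<noteq> 0"
  shows "U \<subseteq> span {e}"
proof
  fix w assume w: "w \<in> U"
  have inv: "span {u} \<in> invariant_subspaces scale S" if u: "u \<in> U" for u
  proof -
    have "g (scale k u) = scale (k * c g) u" if "g \<in> S" for g k
      using endo.linear_scale[OF S[OF that]] scalar[OF that u] by simp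
    then show ?thesis
      unfolding invariant_subspaces_def by (auto simp: subspace_span) (auto simp: span_singleton)
  qed
  from uniserial_comparable[OF uni inv[OF w] inv[OF e(1)]]
  show "w \<in> span {e}"
  proof
    assume "span {w} \<subseteq> span {e}"
    then show ?thesis using span_base by blast
  next
    assume "span {e} \<subseteq> span {w}"
    then have "e \<in> span {w}" using span_base by blast
    then obtain a where a: "e = scale a w" by (auto simp: span_singleton)
    with e(2) have "w = scale (inverse a) e" by auto
    then show ?thesis by (auto simp: span_singleton)
  qed
qed

section \<open>Polynomials in an operator\<close>

text \<open>The value \<open>p(f)\<close>, applied to \<open>w\<close>. The sum has the same shape as the one for polynomials in a
matrix, so that the two can be compared term by term.\<close>
definition poly_operator :: "'a poly \<Rightarrow> ('b \<Rightarrow> 'b) \<Rightarrow> 'b \<Rightarrow> 'b" where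
  "poly_operator p f w = (\<Sum>k\<le>degree p. scale (coeff p k) ((f ^^ k) w))"

text \<open>The upper bound \<open>degree p\<close> changes under every operation on polynomials; a larger common bound
makes the operations termwise.\<close>
lemma poly_operator_eq_sum:
  fixes p :: "'a poly"
  assumes "degree p \<le> N"
  shows "poly_operator p f w = (\<Sum>k\<le>N. scale (coeff p k) ((f ^^ k) w))"
  unfolding poly_operator_def
  by (rule sum.mono_neutral_left) (use assms in \<open>auto simp: coeff_eq_0\<close>)

lemma poly_operator_0: "poly_operator 0 f w = 0"
  by (simp add: poly_operator_def)

lemma poly_operator_add:
  "poly_operator (p + q) f w = poly_operator p f w + poly_operator q f w"
proof -
  let ?N = "max (degree p) (degree q)"
  show ?thesis
    using degree_add_le_max[of p q]
    by (simp add: poly_operator_eq_sum[where N = ?N] scale_left_distrib sum.distrib)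
qed

lemma poly_operator_smult:
  "poly_operator (Polynomial.smult c p) f w = scale c (poly_operator p f w)"
  using Polynomial.degree_smult_le[of c p]
  by (simp add: poly_operator_eq_sum[where N = "degree p"] scale_sum_right)

lemma poly_operator_monom: "poly_operator (monom c k) f w = scale c ((f ^^ k) w)"
proof -
  have "poly_operator (monom c k) f w = (\<Sum>j\<le>k. if k = j then scale c ((f ^^ j) w) else 0)"
    unfolding poly_operator_eq_sum[OF degree_monom_le]
    by (rule sum.cong) auto
  then show ?thesis by simp
qed

lemma poly_operator_pCons_0:
  assumes "Vector_Spaces.linear scale scale f"
  shows "poly_operator (pCons 0 p) f w = f (poly_operator p f w)"
proof -
  have "poly_operator (pCons 0 p) f w
      = (\<Sum>k\<le>Suc (degree p). scale (coeff (pCons 0 p) k) ((f ^^ k) w))"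
    by (rule poly_operator_eq_sum) (rule degree_pCons_le)
  also have "\<dots> = (\<Sum>k\<le>degree p. scale (coeff p k) (f ((f ^^ k) w)))"
    by (subst sum.atMost_Suc_shift) simp
  also have "\<dots> = f (poly_operator p f w)"
    unfolding poly_operator_def
    by (simp add: endo.linear_sum[OF assms] endo.linear_scale[OF assms])
  finally show ?thesis .
qed

lemma linear_poly_operator:
  assumes "Vector_Spaces.linear scale scale f"
  shows "Vector_Spaces.linear scale scale (poly_operator p f)"
  unfolding poly_operator_def
  by (intro endo.linear_compose_sum ballI endo.linear_compose_scale_right linear_funpow assms)

text \<open>The index set \<open>K\<close> controls which powers may occur. With all of the naturals this says that a cyclic
vector generates the space by polynomials; with an initial segment it yields a nontrivial
annihilating polynomial.\<close>
lemma span_orbit_imp_poly_operator: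
  assumes "w \<in> span ((\<lambda>k. (f ^^ k) v) ` K)"
  shows "\<exists>p. (\<forall>k. k \<notin> K \<longrightarrow> coeff p k = 0) \<and> w = poly_operator p f v"
  using assms
proof (induction rule: span_induct_alt)
  case base
  show ?case by (rule exI[of _ 0]) (simp add: poly_operator_0)
next
  case (step c u w)
  then obtain k p where "k \<in> K" "u = (f ^^ k) v"
    and "\<forall>k. k \<notin> K \<longrightarrow> coeff p k = 0" "w = poly_operator p f v"
    by auto
  then show ?case
    by (intro exI[of _ "monom c k + p"]) (auto simp: poly_operator_add poly_operator_monom)
qed

text \<open>An operator that commutes with \<open>f\<close> is determined by its value at a cyclic vector of \<open>f\<close>.\<close>
lemma commuting_eq_poly_operator:
  assumes f: "Vector_Spaces.linear scale scale f"
    and g: "Vector_Spaces.linear scale scale g"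
    and comm: "\<And>w. f (g w) = g (f w)"
    and cyclic: "span (range (\<lambda>k. (f ^^ k) v)) = UNIV"
  shows "\<exists>p. g = poly_operator p f"
proof -
  obtain p where p: "g v = poly_operator p f v"
    using span_orbit_imp_poly_operator[of "g v" f v UNIV] cyclic by auto
  have "g ((f ^^ k) v) = poly_operator p f ((f ^^ k) v)" for k
  proof -
    have swap: "(f ^^ k) ((f ^^ l) v) = (f ^^ l) ((f ^^ k) v)" for l
      by (metis add.commute comp_apply funpow_add)
    have "g ((f ^^ k) v) = (f ^^ k) (poly_operator p f v)"
      by (simp add: funpow_commute[where f = f and g = g, OF comm, symmetric] p)
    also have "\<dots> = poly_operator p f ((f ^^ k) v)"
      unfolding poly_operator_def
      by (simp add: endo.linear_sum[OF linear_funpow[OF f]] endo.linear_scale[OF linear_funpow[OF f]] swap)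
    finally show ?thesis .
  qed
  then have "g w = poly_operator p f w" for w
    using endo.linear_eq_on[OF g linear_poly_operator[OF f], of w "range (\<lambda>k. (f ^^ k) v)"] cyclic
    by auto
  then show ?thesis by blast
qed

text \<open>A cyclic vector of \<open>f - a\<close> is therefore also cyclic for \<open>f\<close>.\<close>
lemma span_orbit_shift_subset:
  assumes f: "Vector_Spaces.linear scale scale f"
  shows "((\<lambda>w. f w - scale a w) ^^ l) v \<in> span (range (\<lambda>k. (f ^^ k) v))"
proof (induction l)
  case 0
  show ?case by (rule span_base) (rule range_eqI[of _ _ 0], simp)
next
  case (Suc l)
  let ?O = "range (\<lambda>k. (f ^^ k) v)"
  have "f ` ?O \<subseteq> ?O"
  proof clarify
    fix k
    have "f ((f ^^ k) v) = (f ^^ Suc k) v" by simp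
    then show "f ((f ^^ k) v) \<in> ?O" by blast
  qed
  then have "f ` span ?O \<subseteq> span ?O"
    unfolding endo.linear_span_image[OF f, symmetric] by (rule span_mono)
  then show ?case
    using Suc by (auto intro!: span_diff span_scale)
qed

section \<open>Matrices of polynomials in an operator\<close>

lemma represented_by_id: "represented_by scale bs (\<lambda>w. w) (1\<^sub>m (length bs))"
proof -
  have "(\<Sum>i<length bs. scale (1\<^sub>m (length bs) $$ (i, j)) (bs ! i)) = bs ! j"
    if "j < length bs" for j
  proof -
    have "(\<Sum>i<length bs. scale (1\<^sub>m (length bs) $$ (i, j)) (bs ! i))
        = (\<Sum>i<length bs. if i = j then bs ! i else 0)"
      by (rule sum.cong) (use that in auto)
    then show ?thesis using that by simp
  qed
  then show ?thesis by (simp add: represented_by_def)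
qed

lemma represented_by_comp:
  assumes f: "Vector_Spaces.linear scale scale f"
    and A: "represented_by scale bs f A" and B: "represented_by scale bs g B"
  shows "represented_by scale bs (\<lambda>w. f (g w)) (A * B)"
proof -
  let ?m = "length bs"
  have dims: "A \<in> carrier_mat ?m ?m" "B \<in> carrier_mat ?m ?m"
    using A B by (auto simp: represented_by_def)
  have "f (g (bs ! j)) = (\<Sum>l<?m. scale ((A * B) $$ (l, j)) (bs ! l))" if j: "j < ?m" for j
  proof -
    have "f (g (bs ! j)) = (\<Sum>i<?m. scale (B $$ (i, j)) (f (bs ! i)))"
      using B j by (simp add: represented_by_def endo.linear_sum[OF f] endo.linear_scale[OF f])
    also have "\<dots> = (\<Sum>i<?m. \<Sum>l<?m. scale (A $$ (l, i) * B $$ (i, j)) (bs ! l))"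
      using A by (simp add: represented_by_def scale_sum_right mult.commute)
    also have "\<dots> = (\<Sum>l<?m. \<Sum>i<?m. scale (A $$ (l, i) * B $$ (i, j)) (bs ! l))"
      by (rule sum.swap)
    also have "\<dots> = (\<Sum>l<?m. scale ((A * B) $$ (l, j)) (bs ! l))"
      using dims j
      by (intro sum.cong) (auto simp: scalar_prod_def scale_sum_left atLeast0LessThan)
    finally show ?thesis .
  qed
  then show ?thesis using dims by (simp add: represented_by_def)
qed

lemma represented_by_funpow:
  assumes f: "Vector_Spaces.linear scale scale f" and A: "represented_by scale bs f A"
  shows "represented_by scale bs (f ^^ k) (A ^\<^sub>m k)"
proof (induction k)
  case 0
  have "dim_row A = length bs" using A by (auto simp: represented_by_def)
  then show ?case using represented_by_id by (simp add: id_def)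
next
  case (Suc k)
  show ?case
    using represented_by_comp[OF linear_funpow[OF f] Suc A]
    by (simp add: funpow_Suc_right comp_def del: funpow.simps)
qed

lemma represented_by_poly_operator:
  assumes f: "Vector_Spaces.linear scale scale f" and A: "represented_by scale bs f A"
  shows "represented_by scale bs (poly_operator p f) (poly_of_mat p A)"
proof -
  let ?m = "length bs"
  have dim: "dim_row A = ?m" using A by (auto simp: represented_by_def)
  have "poly_operator p f (bs ! j) = (\<Sum>i<?m. scale (poly_of_mat p A $$ (i, j)) (bs ! i))"
    if j: "j < ?m" for j
  proof -
    have "poly_operator p f (bs ! j)
        = (\<Sum>k\<le>degree p. \<Sum>i<?m. scale (coeff p k * (A ^\<^sub>m k) $$ (i, j)) (bs ! i))"
      using represented_by_funpow[OF f A] j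
      by (simp add: poly_operator_def represented_by_def scale_sum_right)
    also have "\<dots> = (\<Sum>i<?m. \<Sum>k\<le>degree p. scale (coeff p k * (A ^\<^sub>m k) $$ (i, j)) (bs ! i))"
      by (rule sum.swap)
    also have "\<dots> = (\<Sum>i<?m. scale (poly_of_mat p A $$ (i, j)) (bs ! i))"
      using j by (intro sum.cong) (auto simp: poly_of_mat_def dim scale_sum_left)
    finally show ?thesis .
  qed
  then show ?thesis by (simp add: represented_by_def poly_of_mat_def dim)
qed

section \<open>Jordan chains\<close>

text \<open>The vectors \<open>b 0, \<dots>, b (i - 1)\<close> are killed by \<open>y\<^sup>i\<close>, whereas \<open>y\<^sup>i (b i) = y\<^sup>k v \<noteq> 0\<close>; this gives
independence. The chain spans because the kernels of the powers of \<open>y\<close> grow by at most one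
dimension at each step: \<open>y\<^sup>r\<close> maps the kernel of \<open>y\<^sup>r\<^sup>+\<^sup>1\<close> into the line \<open>ker y\<close>, and \<open>y\<^sup>r (b r)\<close> already
spans that line.\<close>
lemma nilpotent_one_dim_kernel_basis:
  assumes y: "Vector_Spaces.linear scale scale y"
    and top: "(y ^^ k) v \<noteq> 0"
    and nil: "\<And>w. (y ^^ Suc k) w = 0"
    and ker: "{w. y w = 0} \<subseteq> span {e}"
  defines "b \<equiv> \<lambda>j. (y ^^ (k - j)) v"
  shows "inj_on b {..<Suc k} \<and> independent (b ` {..<Suc k}) \<and> span (b ` {..<Suc k}) = UNIV"
proof -
  have "b i \<notin> span (b ` {..<i})" if i: "i < Suc k" for i
  proof
    have pow: "(y ^^ i) (b j) = (y ^^ (i + (k - j))) v" for j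
      by (simp add: b_def funpow_add)
    have "(y ^^ i) (b j) = 0" if "j < i" for j
    proof -
      have "i + (k - j) = Suc k + (i - Suc j)" using that i by simp
      then show ?thesis using nil by (simp only: pow funpow_add comp_apply)
    qed
    then have "b ` {..<i} \<subseteq> {w. (y ^^ i) w = 0}" by auto
    then have "span (b ` {..<i}) \<subseteq> {w. (y ^^ i) w = 0}"
      by (rule span_minimal) (rule endo.linear_subspace_kernel[OF linear_funpow[OF y]])
    moreover assume "b i \<in> span (b ` {..<i})"
    ultimately have "(y ^^ i) (b i) = 0" by auto
    then show False using i top by (simp add: pow)
  qed
  then have indep: "inj_on b {..<Suc k} \<and> independent (b ` {..<Suc k})"
    by (rule independent_if_not_in_span_of_predecessors)
  have "w \<in> span (b ` {..<Suc k})" if "(y ^^ r) w = 0" "r \<le> Suc k" for r w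
    using that
  proof (induction r arbitrary: w)
    case 0
    then show ?case by (simp add: span_zero)
  next
    case (Suc r)
    have r: "r \<le> k" using Suc.prems by simp
    have "(y ^^ r) w \<in> span {e}" using Suc.prems ker by auto
    moreover have "(y ^^ k) v \<in> span {e}" using nil[of v] ker by auto
    ultimately obtain c d where "(y ^^ r) w = scale c e" "(y ^^ k) v = scale d e"
      by (auto simp: span_singleton)
    with top have "(y ^^ r) w = scale (c / d) ((y ^^ k) v)" by auto
    also have "(y ^^ k) v = (y ^^ r) (b r)"
      using r by (simp add: b_def funpow_add[THEN fun_cong, simplified, symmetric])
    finally have "(y ^^ r) (w - scale (c / d) (b r)) = 0"
      by (simp add: endo.linear_diff[OF linear_funpow[OF y]] endo.linear_scale[OF linear_funpow[OF y]])
    then have "w - scale (c / d) (b r) \<in> span (b ` {..<Suc k})"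
      using Suc.IH r by simp
    moreover have "scale (c / d) (b r) \<in> span (b ` {..<Suc k})"
      using r by (intro span_scale span_base) auto
    ultimately show ?case using span_add by fastforce
  qed
  then show ?thesis using indep nil by blast
qed

text \<open>The chain is listed from the eigenvector upwards because \<open>f (b j) = a b j + b (j - 1)\<close> then puts the
ones above the diagonal. The hypothesis on \<open>v\<close> accounts for the first column.\<close>
lemma represented_by_jordan_block:
  fixes f :: "'b \<Rightarrow> 'b" and a :: 'a
  defines "y \<equiv> \<lambda>w. f w - scale a w"
  assumes nil: "(y ^^ Suc k) v = 0"
  shows "represented_by scale (map (\<lambda>j. (y ^^ (k - j)) v) [0..<Suc k]) f (jordan_block (Suc k) a)"
proof -
  let ?b = "\<lambda>j. (y ^^ (k - j)) v"
  have fb: "f (?b j) = (\<Sum>i<Suc k. scale (jordan_block (Suc k) a $$ (i, j)) (?b i))"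
    if j: "j < Suc k" for j
  proof -
    have "(\<Sum>i<Suc k. scale (jordan_block (Suc k) a $$ (i, j)) (?b i))
        = (\<Sum>i<Suc k. (if i = j then scale a (?b i) else 0) + (if Suc i = j then ?b i else 0))"
      by (rule sum.cong) (use j in \<open>auto simp: jordan_block_def\<close>)
    also have "\<dots> = scale a (?b j) + (\<Sum>i<Suc k. if Suc i = j then ?b i else 0)"
      using j by (simp add: sum.distrib del: sum.lessThan_Suc)
    also have "(\<Sum>i<Suc k. if Suc i = j then ?b i else 0) = y (?b j)"
    proof (cases j)
      case 0
      then show ?thesis using nil by simp
    next
      case (Suc i)
      then have "k - i = Suc (k - j)" using j by simp
      then show ?thesis using Suc j by (simp del: sum.lessThan_Suc)
    qed
    finally show ?thesis by (simp add: y_def)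
  qed
  have "map ?b [0..<Suc k] ! j = ?b j" if "j < Suc k" for j
    using nth_map_upt[of j "Suc k" 0 ?b] that by simp
  then show ?thesis
    using fb by (simp add: represented_by_def del: sum.lessThan_Suc upt_Suc)
qed

end

section \<open>Eigenvalues and nilpotency\<close>

text \<open>Once \<open>y\<^sup>N\<close> and \<open>y\<^sup>2\<^sup>N\<close> have the same kernel, the kernel of \<open>y\<^sup>N\<close> meets its range only in zero. Both are
invariant, and the kernel contains \<open>e\<close>, so comparability leaves only the case that the range is
contained in the kernel; then \<open>y\<^sup>2\<^sup>N = 0\<close>, hence already \<open>y\<^sup>N = 0\<close>.\<close>
lemma uniserial_kernel_imp_nilpotent:
  fixes scale :: "'f::field \<Rightarrow> 'v::ab_group_add \<Rightarrow> 'v"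
  assumes fd: "finite_dimensional_vector_space scale Basis"
    and uni: "uniserial scale S"
    and S: "\<And>g. g \<in> S \<Longrightarrow> Vector_Spaces.linear scale scale g"
    and y: "Vector_Spaces.linear scale scale y"
    and comm: "\<And>g w. g \<in> S \<Longrightarrow> y (g w) = g (y w)"
    and e: "y e = 0" "e \<noteq> 0"
  shows "\<exists>N. \<forall>w. (y ^^ N) w = 0"
proof -
  interpret finite_dimensional_vector_space scale Basis by (rule fd)
  interpret vector_space_endomorphisms scale ..
  let ?K = "\<lambda>N. {w. (y ^^ N) w = 0}"
  \<comment> \<open>The maximum is taken over positive exponents, since \<open>e\<close> need not lie in the kernel of \<open>y\<^sup>0\<close>.\<close>
  have "\<exists>L. \<forall>M. dim (?K (Suc M)) \<le> dim (?K (Suc L))"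
    using ex_has_greatest_nat[of "\<lambda>_. True" 0 "\<lambda>L. dim (?K (Suc L))" "Suc dimension"] dim_subset_UNIV
    by (auto simp: less_Suc_eq_le)
  then obtain L where L: "\<And>M. dim (?K (Suc M)) \<le> dim (?K (Suc L))" by blast
  define N where "N = Suc L"
  have N: "dim (?K (N + N)) \<le> dim (?K N)"
    using L[of "L + Suc L"] by (simp add: N_def)
  note pow = linear_funpow[OF y]
  have stable: "(y ^^ N) w = 0" if "(y ^^ N) ((y ^^ N) w) = 0" for w
  proof -
    have "?K N \<subseteq> ?K (N + N)"
      using endo.linear_0[OF pow[of N]] by (auto simp: funpow_add)
    then have "?K N = ?K (N + N)"
      using subspace_dim_equal[OF endo.linear_subspace_kernel[OF pow] endo.linear_subspace_kernel[OF pow]] N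
      by blast
    then show ?thesis using that by (auto simp: funpow_add)
  qed
  have comm': "(y ^^ N) (g w) = g ((y ^^ N) w)" if "g \<in> S" for g w
    using funpow_commute[of y g] comm that by blast
  have "?K N \<subseteq> range (y ^^ N) \<or> range (y ^^ N) \<subseteq> ?K N"
    using uni kernel_in_invariant_subspaces[OF pow S comm'] range_in_invariant_subspaces[OF pow comm']
    by (rule uniserial_comparable)
  then show ?thesis
  proof
    assume sub: "?K N \<subseteq> range (y ^^ N)"
    have ye: "(y ^^ N) e = 0"
      unfolding N_def using e(1) endo.linear_0[OF pow[of L]]
      by (simp add: funpow_Suc_right del: funpow.simps)
    with sub obtain u where u: "e = (y ^^ N) u" by blast
    with ye stable e(2) show ?thesis by metis
  next
    assume "range (y ^^ N) \<subseteq> ?K N"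
    then show ?thesis using stable by blast
  qed
qed

text \<open>Finite dimension provides a nonzero polynomial \<open>p\<close> with \<open>p(f) v = 0\<close>. If \<open>p\<close> has least degree
and \<open>a\<close> is a root of it, say \<open>p = (X - a) s\<close>, then \<open>s(f) v\<close> is nonzero and is an
eigenvector for \<open>a\<close>.\<close>
lemma eigenvector_exists:
  fixes scale :: "'f::alg_closed_field \<Rightarrow> 'v::ab_group_add \<Rightarrow> 'v" and v :: 'v
  assumes fd: "finite_dimensional_vector_space scale Basis"
    and f: "Vector_Spaces.linear scale scale f"
    and v: "v \<noteq> 0"
  shows "\<exists>a e. e \<noteq> 0 \<and> f e = scale a e"
proof -
  interpret finite_dimensional_vector_space scale Basis by (rule fd)
  interpret vector_space_endomorphisms scale ..
  have "\<exists>r. (f ^^ r) v \<in> span ((\<lambda>k. (f ^^ k) v) ` {..<r})"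
  proof (rule ccontr)
    assume "\<not> ?thesis"
    then have *: "inj_on (\<lambda>k. (f ^^ k) v) {..<Suc dimension} \<and>
        independent ((\<lambda>k. (f ^^ k) v) ` {..<Suc dimension})"
      by (intro independent_if_not_in_span_of_predecessors) blast
    then have "card ((\<lambda>k. (f ^^ k) v) ` {..<Suc dimension}) = Suc dimension"
      by (subst card_image) auto
    then show False
      using * independent_card_le_dim[of "(\<lambda>k. (f ^^ k) v) ` {..<Suc dimension}" UNIV]
        dim_subset_UNIV[of UNIV] by auto
  qed
  then obtain r q where q: "Polynomial.coeff q r = 0" "(f ^^ r) v = poly_operator q f v"
    using span_orbit_imp_poly_operator by (metis lessThan_iff less_irrefl)
  \<comment> \<open>The coefficient of \<open>q\<close> at \<open>r\<close> vanishes, so subtracting \<open>q\<close> cannot cancel the monomial.\<close>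
  let ?p = "monom 1 r + Polynomial.smult (- 1) q"
  have "coeff ?p r \<noteq> 0" using q(1) by simp
  then have "?p \<noteq> 0" by (metis coeff_0)
  moreover have "poly_operator ?p f v = 0"
    unfolding poly_operator_add poly_operator_smult poly_operator_monom using q(2) by simp
  ultimately obtain p where p: "p \<noteq> 0" "poly_operator p f v = 0"
    and least: "\<And>q. q \<noteq> 0 \<Longrightarrow> poly_operator q f v = 0 \<Longrightarrow> degree p \<le> degree q"
    using ex_has_least_nat[of "\<lambda>p. p \<noteq> 0 \<and> poly_operator p f v = 0" ?p degree] by metis
  have "degree p \<noteq> 0"
  proof
    assume "degree p = 0"
    then show False using p v by (auto simp: poly_operator_def elim: degree_eq_zeroE)
  qed
  then obtain a where "poly p a = 0" using alg_closed_imp_poly_has_root[of p] by blast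
  then obtain s where s: "p = [:- a, 1:] * s" by (auto simp: poly_eq_0_iff_dvd dvd_def)
  with p(1) have "s \<noteq> 0" by auto
  moreover have "degree p = Suc (degree s)"
    unfolding s by (subst degree_mult_eq) (use \<open>s \<noteq> 0\<close> in simp_all)
  ultimately have "poly_operator s f v \<noteq> 0" using least by fastforce
  moreover have "f (poly_operator s f v) = scale a (poly_operator s f v)"
  proof -
    have "p = pCons 0 s + Polynomial.smult (- a) s" using s by simp
    then show ?thesis
      using p(2) by (simp add: poly_operator_add poly_operator_pCons_0[OF f] poly_operator_smult del: smult_minus_left)
  qed
  ultimately show ?thesis by blast
qed

section \<open>Commuting uniserial families\<close>

theorem theorem2p3:
  fixes scale :: "'f::alg_closed_field \<Rightarrow> 'v::ab_group_add \<Rightarrow> 'v"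
    and Basis :: "'v set"
    and x :: "nat \<Rightarrow> 'v \<Rightarrow> 'v"
    and m n :: nat
  assumes "finite_dimensional_vector_space scale Basis"
    and "\<exists>v::'v. v \<noteq> 0"
    and "m = vector_space.dim scale (UNIV :: 'v set)"
    and "n \<ge> 1"
    and "\<And>i. i \<in> {1..n} \<Longrightarrow> Vector_Spaces.linear scale scale (x i)"
    and "uniserial scale (x ` {1..n})"
    and "\<And>i j. i \<in> {1..n} \<Longrightarrow> j \<in> {1..n} \<Longrightarrow> x i \<circ> x j = x j \<circ> x i"
  shows "\<exists>i\<in>{1..n}. \<exists>\<alpha>. \<exists>bs.
           ordered_basis scale bs \<and>
           represented_by scale bs (x i) (jordan_block m \<alpha>) \<and>
           (\<forall>j\<in>{1..n} - {i}. \<exists>p.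
              represented_by scale bs (x j) (poly_of_mat p (jordan_block m \<alpha>)))"
proof -
  interpret finite_dimensional_vector_space scale Basis by (rule assms(1))
  interpret vector_space_endomorphisms scale ..
  let ?S = "x ` {1..n}"
  have S: "Vector_Spaces.linear scale scale g" if "g \<in> ?S" for g
    using that assms(5) by blast
  have comm: "x i (x j w) = x j (x i w)" if "i \<in> {1..n}" "j \<in> {1..n}" for i j w
    using assms(7)[OF that] by (metis comp_apply)
  have "\<exists>a e. e \<noteq> 0 \<and> x i e = scale a e" if "i \<in> {1..n}" for i
    using eigenvector_exists[OF assms(1) assms(5)[OF that]] assms(2) by blast
  then obtain a e where ae: "\<And>i. i \<in> {1..n} \<Longrightarrow> e i \<noteq> 0 \<and> x i (e i) = scale (a i) (e i)"
    by metis
  define y where "y i = (\<lambda>w. x i w - scale (a i) w)" for i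
  have lin_y: "Vector_Spaces.linear scale scale (y i)" if "i \<in> {1..n}" for i
    unfolding y_def by (rule linear_shift) (rule assms(5)[OF that])
  have comm_y: "y i (g w) = g (y i w)" if "i \<in> {1..n}" "g \<in> ?S" for i g w
    using that comm endo.linear_diff[OF S] endo.linear_scale[OF S] by (auto simp: y_def)
  define E where "E i = {w. y i w = 0}" for i
  have E: "E i \<in> invariant_subspaces scale ?S" if "i \<in> {1..n}" for i
    unfolding E_def by (rule kernel_in_invariant_subspaces[OF lin_y[OF that] S comm_y[OF that]])
  have "E ` {1..n} \<noteq> {}" using assms(4) by auto
  then obtain i where i: "i \<in> {1..n}" and min: "\<And>j. j \<in> {1..n} \<Longrightarrow> E j \<subseteq> E i \<Longrightarrow> E i = E j"
    using finite_has_minimal[of "E ` {1..n}"] by auto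
  \<comment> \<open>Any two eigenspaces are comparable, so a minimal one is least.\<close>
  have least: "E i \<subseteq> E j" if "j \<in> {1..n}" for j
    using uniserial_comparable[OF assms(6) E[OF i] E[OF that]] min[OF that] by blast
  \<comment> \<open>On \<open>E i\<close>, which lies in every \<open>E j\<close>, each \<open>x j\<close> is multiplication by \<open>a j\<close>.\<close>
  have "\<exists>c. \<forall>w\<in>E i. g w = scale c w" if "g \<in> ?S" for g
    using that least by (fastforce simp: E_def y_def)
  then obtain c where c: "\<And>g w. g \<in> ?S \<Longrightarrow> w \<in> E i \<Longrightarrow> g w = scale (c g) w"
    by metis
  have ei: "e i \<noteq> 0" "y i (e i) = 0" using ae[OF i] by (auto simp: y_def)
  have line: "{w. y i w = 0} \<subseteq> span {e i}"
    using scalar_action_uniserial_imp_line[OF assms(6) S c, of "E i" "e i"] ei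
    unfolding E_def by blast
  have "\<exists>N. \<forall>w. (y i ^^ N) w = 0"
    using uniserial_kernel_imp_nilpotent[OF assms(1) assms(6) S lin_y[OF i] comm_y[OF i] ei(2) ei(1)] .
  then obtain N where N: "\<And>w. (y i ^^ N) w = 0"
    and N_least: "\<And>M. M < N \<Longrightarrow> \<exists>w. (y i ^^ M) w \<noteq> 0"
    using exists_least_iff[of "\<lambda>N. \<forall>w. (y i ^^ N) w = 0"] by blast
  have "N \<noteq> 0" using N[of "e i"] ei(1) by (cases N) auto
  then obtain k where k: "N = Suc k" using not0_implies_Suc by blast
  then obtain v where v: "(y i ^^ k) v \<noteq> 0" using N_least by blast
  define b where "b = (\<lambda>j. (y i ^^ (k - j)) v)"
  have basis: "inj_on b {..<Suc k}" "independent (b ` {..<Suc k})" "span (b ` {..<Suc k}) = UNIV"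
    using nilpotent_one_dim_kernel_basis[OF lin_y[OF i] v N[unfolded k] line] unfolding b_def by auto
  have m: "m = Suc k"
    using assms(3) dim_eq_card_independent[OF basis(2)] card_image[OF basis(1)] dim_span[of "b ` {..<Suc k}"] basis(3)
    by simp
  define bs where "bs = map b [0..<Suc k]"
  have "set bs = b ` {..<Suc k}" by (auto simp: bs_def simp del: upt_Suc)
  then have ordered: "ordered_basis scale bs"
    using basis by (auto simp: ordered_basis_def bs_def distinct_map atLeast0LessThan simp del: upt_Suc)
  have jordan: "represented_by scale bs (x i) (jordan_block m (a i))"
    using represented_by_jordan_block[where f = "x i" and a = "a i" and k = k and v = v] N[of v]
    unfolding m bs_def b_def k y_def by blast
  have "b ` {..<Suc k} \<subseteq> span (range (\<lambda>l. (x i ^^ l) v))"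
    using span_orbit_shift_subset[OF assms(5)[OF i]] by (auto simp: b_def y_def)
  then have "span (range (\<lambda>l. (x i ^^ l) v)) = UNIV"
    using span_minimal[OF _ subspace_span] basis(3) by blast
  then have "\<exists>p. x j = poly_operator p (x i)" if "j \<in> {1..n}" for j
    using commuting_eq_poly_operator[OF assms(5)[OF i] assms(5)[OF that] comm[OF i that]] by blast
  then have "\<exists>p. represented_by scale bs (x j) (poly_of_mat p (jordan_block m (a i)))"
    if "j \<in> {1..n}" for j
    using represented_by_poly_operator[OF assms(5)[OF i] jordan] that by metis
  then show ?thesis using i ordered jordan by blast
qed

end
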